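(* For any $u\in l^2(\mathbb{Z})$ the inequality $$\sup_{n\in\mathbb{Z}}u(n)^2\le\|u\|\,\|\mathrm{D}u\|$$ holds, the constant $1$ is sharp, and there are no (nonzero) extremals. The following refined inequality holds for every nonzero $u\in l^2(\mathbb{Z})$: $$u(0)^2\le\frac12\sqrt{4-\frac{\|\mathrm{D}u\|^2}{\|u\|^2}}\;\|u\|\,\|\mathrm{D}u\|.$$ For any $0<d<4$, $d\neq2$, this refined inequality becomes an equality for $u^*_{\lambda(d)}=G_{\lambda(d)}$, where $\lambda(d)=\frac{2d}{2-d}$, and $\|\mathrm{D}u^*_{\lambda(d)}\|^2/\|u^*_{\lambda(d)}\|^2=d$. For $d=2$ the same is true with $u^*=\delta$.
   Context: Sequences are real-valued. For $u\in l^2(\mathbb{Z})$: $\mathrm{D}u(n)=u(n+1)-u(n)$, $\|u\|^2=\sum_{k}u(k)^2$, $\|\mathrm{D}u\|^2=\sum_{k}(\mathrm{D}u(k))^2$, $\mathrm{D}^*u(n)=-(u(n)-u(n-1))$, so $\mathrm{D}^*\mathrm{D}u(n)=-(u(n+1)-2u(n)+u(n-1))$, an operator with spectrum $[0,4]$. Let $\mathbb{A}(\lambda)=\mathrm{D}^*\mathrm{D}+\lambda$ for $\lambda>0$ and $\mathbb{A}(\lambda)=-\mathrm{D}^*\mathrm{D}-\lambda$ for $\lambda<-4$. The sequence $\delta$ is defined by $\delta(0)=1$, $\delta(n)=0$ for $n\ne0$, and $G_\lambda\in l^2(\mathbb{Z})$ is the Green's function, the solution of $\mathbb{A}(\lambda)G_\lambda=\delta$.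 *)

theory Defs
  imports "HOL-Analysis.Analysis"
begin

definition l2 :: "(int \<Rightarrow> real) set" where
  "l2 = {u. (\<lambda>k. (u k)\<^sup>2) summable_on UNIV}"

text \<open>Meaningful on \<open>l2\<close> only: \<open>infsum\<close> is 0 for a family that is not summable.\<close>

definition l2norm :: "(int \<Rightarrow> real) \<Rightarrow> real" where
  "l2norm u = sqrt (\<Sum>\<^sub>\<infinity>k. (u k)\<^sup>2)"

definition D :: "(int \<Rightarrow> real) \<Rightarrow> int \<Rightarrow> real" where
  "D u n = u (n + 1) - u n"

definition Dstar :: "(int \<Rightarrow> real) \<Rightarrow> int \<Rightarrow> real" where
  "Dstar u n = - (u n - u (n - 1))"

text \<open>The operator is intended for \<open>\<mu> > 0\<close> and \<open>\<mu> < -4\<close>, that is, for \<open>-\<mu>\<close> outside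
  the spectrum \<open>[0,4]\<close> of \<open>Dstar \<circ> D\<close>; the value for other \<open>\<mu>\<close> is irrelevant.\<close>

definition A_op :: "real \<Rightarrow> (int \<Rightarrow> real) \<Rightarrow> int \<Rightarrow> real" where
  "A_op \<mu> u n =
     (if \<mu> > 0 then Dstar (D u) n + \<mu> * u n else - Dstar (D u) n - \<mu> * u n)"

definition delta :: "int \<Rightarrow> real" where
  "delta n = (if n = 0 then 1 else 0)"

definition green :: "real \<Rightarrow> int \<Rightarrow> real" where
  "green \<mu> = (THE G. G \<in> l2 \<and> A_op \<mu> G = delta)"

definition lambda_of :: "real \<Rightarrow> real" where
  "lambda_of d = 2 * d / (2 - d)"

end

theory Submission
  imports Defs
begin

text \<open>Put \<open>P u n = u (n + 1) + u n\<close>. The parallelogram identity gives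
  \<open>\<parallel>D u\<parallel>\<^sup>2 + \<parallel>P u\<parallel>\<^sup>2 = 4 \<parallel>u\<parallel>\<^sup>2\<close>, so the refined inequality reads \<open>2 u(0)\<^sup>2 \<le> \<parallel>D u\<parallel> \<parallel>P u\<parallel>\<close>.
  Since \<open>D u n \<cdot> P u n = u(n + 1)\<^sup>2 - u(n)\<^sup>2\<close>, telescoping over both half-lines followed by
  Cauchy--Schwarz proves it. Translation invariance and \<open>4 \<parallel>u\<parallel>\<^sup>2 - \<parallel>D u\<parallel>\<^sup>2 < 4 \<parallel>u\<parallel>\<^sup>2\<close> give the
  first inequality, strictly. Green's functions and \<open>\<delta>\<close> are multiples of \<open>r\<^bsup>|n|\<^esup>\<close>
  with \<open>|r| < 1\<close>, for which all norms are geometric series; \<open>r \<rightarrow> 1\<close> gives sharpness.\<close>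

section \<open>Auxiliary sequences, sums over the integers, and the space \<open>l2\<close>\<close>

definition P :: "(int \<Rightarrow> real) \<Rightarrow> int \<Rightarrow> real" where
  "P u n = u (n + 1) + u n"

text \<open>The convention \<open>0 ^ 0 = 1\<close> makes \<open>geo 0\<close> equal to
  \<open>delta\<close>, so the case \<open>d = 2\<close> falls under the same formulas.\<close>

definition geo :: "real \<Rightarrow> int \<Rightarrow> real" where
  "geo r n = r ^ nat \<bar>n\<bar>"

text \<open>The negative integers are enumerated by \<open>- int n - 1\<close>, so 0 is counted only
  once.\<close>

lemma has_sum_int_halves:
  fixes f :: "int \<Rightarrow> real"
  assumes "((\<lambda>n. f (int n)) has_sum a) UNIV" "((\<lambda>n. f (- int n - 1)) has_sum b) UNIV"
  shows "(f has_sum (a + b)) UNIV"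
proof -
  have "bij_betw int UNIV {0..}"
    by (rule bij_betwI[where g = nat]) auto
  then have 1: "(f has_sum a) {0..}"
    using assms(1) has_sum_reindex_bij_betw by blast
  have "bij_betw (\<lambda>n. - int n - 1) UNIV {..<0}"
    by (rule bij_betwI[where g = "\<lambda>k. nat (- k - 1)"]) auto
  then have 2: "(f has_sum b) {..<0}"
    using assms(2) has_sum_reindex_bij_betw[of "\<lambda>n. - int n - 1" UNIV "{..<0}" f b] by simp
  have "{0..} \<union> {..<0} = (UNIV :: int set)" "{0..} \<inter> {..<0} = ({} :: int set)"
    by auto
  with has_sum_Un_disjoint[OF 1 2] show ?thesis by simp
qed

lemma has_sum_int_shift:
  fixes f :: "int \<Rightarrow> real" and m :: int
  shows "((\<lambda>n. f (n + m)) has_sum s) UNIV \<longleftrightarrow> (f has_sum s) UNIV"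
  by (rule has_sum_reindex_bij_betw) (rule bij_betwI[where g = "\<lambda>k. k - m"], auto)

lemma l2I: "((\<lambda>k. (u k)\<^sup>2) has_sum s) UNIV \<Longrightarrow> u \<in> l2"
  by (auto simp: l2_def summable_on_def)

lemma l2norm_sq: "(l2norm u)\<^sup>2 = (\<Sum>\<^sub>\<infinity>k. (u k)\<^sup>2)"
  by (simp add: l2norm_def infsum_nonneg)

lemma l2norm_nonneg: "0 \<le> l2norm u"
  by (simp add: l2norm_def infsum_nonneg)

lemma l2norm_sqI: "((\<lambda>k. (u k)\<^sup>2) has_sum s) UNIV \<Longrightarrow> (l2norm u)\<^sup>2 = s"
  by (simp add: l2norm_sq infsumI)

lemma has_sum_l2norm_sq: "u \<in> l2 \<Longrightarrow> ((\<lambda>k. (u k)\<^sup>2) has_sum (l2norm u)\<^sup>2) UNIV"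
  by (simp add: l2norm_sq l2_def)

lemma sum_le_l2norm_sq:
  assumes "u \<in> l2" "finite F"
  shows "(\<Sum>k\<in>F. (u k)\<^sup>2) \<le> (l2norm u)\<^sup>2"
  using assms unfolding l2norm_sq l2_def by (intro finite_sum_le_infsum) auto

lemma l2norm_eq_0_iff:
  assumes "u \<in> l2"
  shows "l2norm u = 0 \<longleftrightarrow> u = (\<lambda>_. 0)"
proof
  assume "l2norm u = 0"
  then have "(u n)\<^sup>2 \<le> 0" for n
    using sum_le_l2norm_sq[OF assms, of "{n}"] by simp
  then show "u = (\<lambda>_. 0)" by auto
qed (simp add: l2norm_def)

lemma l2_shift: "u \<in> l2 \<Longrightarrow> (\<lambda>n. u (n + m)) \<in> l2"
  and l2norm_shift: "u \<in> l2 \<Longrightarrow> l2norm (\<lambda>n. u (n + m)) = l2norm u"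
proof -
  assume u: "u \<in> l2"
  have *: "((\<lambda>k. (u (k + m))\<^sup>2) has_sum (l2norm u)\<^sup>2) UNIV"
    using has_sum_l2norm_sq[OF u] has_sum_int_shift[of "\<lambda>k. (u k)\<^sup>2"] by simp
  show "(\<lambda>n. u (n + m)) \<in> l2" using * by (rule l2I)
  show "l2norm (\<lambda>n. u (n + m)) = l2norm u"
    using l2norm_sqI[OF *] by (simp add: l2norm_nonneg)
qed

section \<open>Parallelogram identity, pointwise bound and strictness\<close>

lemma parallelogram:
  assumes "u \<in> l2"
  shows "D u \<in> l2" "P u \<in> l2" "(l2norm (D u))\<^sup>2 + (l2norm (P u))\<^sup>2 = 4 * (l2norm u)\<^sup>2"
proof -
  let ?v = "\<lambda>n. u (n + 1)"
  \<comment> \<open>Pointwise, \<open>2 x^2 + 2 y^2 = (x - y)^2 + (x + y)^2\<close>. Summability of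
    this total comes first; it dominates each of the two squares.\<close>
  have "((\<lambda>k. 2 * (?v k)\<^sup>2 + 2 * (u k)\<^sup>2) has_sum (2 * (l2norm ?v)\<^sup>2 + 2 * (l2norm u)\<^sup>2)) UNIV"
    by (intro has_sum_add has_sum_cmult_right has_sum_l2norm_sq l2_shift assms)
  moreover have "2 * (?v k)\<^sup>2 + 2 * (u k)\<^sup>2 = (D u k)\<^sup>2 + (P u k)\<^sup>2" for k
    by (simp add: D_def P_def power2_eq_square algebra_simps)
  ultimately have *: "((\<lambda>k. (D u k)\<^sup>2 + (P u k)\<^sup>2) has_sum 4 * (l2norm u)\<^sup>2) UNIV"
    by (simp add: l2norm_shift assms)
  then have s: "(\<lambda>k. (D u k)\<^sup>2 + (P u k)\<^sup>2) summable_on UNIV"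
    by (auto simp: summable_on_def)
  show D: "D u \<in> l2" unfolding l2_def
    by (auto intro!: summable_on_comparison_test[OF s])
  show P: "P u \<in> l2" unfolding l2_def
    by (auto intro!: summable_on_comparison_test[OF s])
  have "((\<lambda>k. (D u k)\<^sup>2 + (P u k)\<^sup>2) has_sum ((l2norm (D u))\<^sup>2 + (l2norm (P u))\<^sup>2)) UNIV"
    by (intro has_sum_add has_sum_l2norm_sq D P)
  with * show "(l2norm (D u))\<^sup>2 + (l2norm (P u))\<^sup>2 = 4 * (l2norm u)\<^sup>2"
    using has_sum_unique by blast
qed

text \<open>Injectivity turns the values along \<open>f\<close> into a subfamily of a summable
  family, hence into a convergent series. Used for the boundary terms at -N and N.\<close>

lemma l2_tendsto_zero:
  assumes "u \<in> l2" "inj f"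
  shows "(\<lambda>N :: nat. (u (f N))\<^sup>2) \<longlonglongrightarrow> 0"
proof -
  have "(\<lambda>k. (u k)\<^sup>2) summable_on range f"
    using assms(1) unfolding l2_def by (auto intro: summable_on_subset_banach)
  then have "(\<lambda>N. (u (f N))\<^sup>2) summable_on UNIV"
    using summable_on_reindex[OF assms(2), of "\<lambda>k. (u k)\<^sup>2"] by (simp add: o_def)
  then show ?thesis
    using summable_LIMSEQ_zero summable_on_UNIV_nonneg_real_iff by fastforce
qed

text \<open>Telescoping from -N up to 0 and from N down to 0 bounds \<open>(u 0)^2\<close> twice;
  adding the two bounds produces the factor 2.\<close>

lemma telescope_halves:
  fixes u :: "int \<Rightarrow> real"
  shows "2 * (u 0)\<^sup>2 \<le> (u (- int N))\<^sup>2 + (u (int N))\<^sup>2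
    + (\<Sum>k\<in>{- int N..<int N}. \<bar>D u k\<bar> * \<bar>P u k\<bar>)"
proof (induction N)
  case (Suc N)
  \<comment> \<open>One new edge on either side, at \<open>- int N - 1\<close> and
    \<open>int N\<close>. Their summands pay for moving the two boundary values one place
    outward.\<close>
  have "{- int (Suc N)..<int (Suc N)}
      = insert (- int N - 1) (insert (int N) {- int N..<int N})"
    by auto
  then have "(\<Sum>k\<in>{- int (Suc N)..<int (Suc N)}. \<bar>D u k\<bar> * \<bar>P u k\<bar>)
      = \<bar>D u (- int N - 1) * P u (- int N - 1)\<bar> + \<bar>D u (int N) * P u (int N)\<bar>
        + (\<Sum>k\<in>{- int N..<int N}. \<bar>D u k\<bar> * \<bar>P u k\<bar>)"
    by (simp add: abs_mult)
  moreover have "D u k * P u k = (u (k + 1))\<^sup>2 - (u k)\<^sup>2" for k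
    by (simp add: D_def P_def power2_eq_square algebra_simps)
  moreover have "u (- int (Suc N)) = u (- int N - 1)" "u (int (Suc N)) = u (int N + 1)"
    by (rule arg_cong[of _ _ u], simp)+
  ultimately show ?case
    using Suc.IH by simp
qed simp

lemma point_bound:
  assumes "u \<in> l2"
  shows "(u n)\<^sup>2 \<le> 1/2 * (l2norm (D u) * l2norm (P u))"
proof -
  \<comment> \<open>The value at 0 suffices: \<open>D\<close> and \<open>P\<close> commute with
    translations, which preserve the norm.\<close>
  have zero: "2 * (v 0)\<^sup>2 \<le> l2norm (D v) * l2norm (P v)" if v: "v \<in> l2" for v
  proof -
    note DP = parallelogram(1,2)[OF v]
    have fin: "2 * (v 0)\<^sup>2 \<le> (v (- int N))\<^sup>2 + (v (int N))\<^sup>2 + l2norm (D v) * l2norm (P v)"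
      for N
    proof -
      let ?I = "{- int N..<int N}"
      have L2: "L2_set w ?I \<le> l2norm w" if "w \<in> l2" for w
        unfolding L2_set_def
        using sum_le_l2norm_sq[OF that, of ?I] real_le_lsqrt l2norm_nonneg by simp
      have "(\<Sum>k\<in>?I. \<bar>D v k\<bar> * \<bar>P v k\<bar>) \<le> L2_set (D v) ?I * L2_set (P v) ?I"
        by (rule L2_set_mult_ineq)
      also have "\<dots> \<le> l2norm (D v) * l2norm (P v)"
        by (intro mult_mono L2 DP l2norm_nonneg L2_set_nonneg)
      finally show ?thesis
        using telescope_halves[of v N] by linarith
    qed
    \<comment> \<open>The window grows to all integers; both boundary terms vanish in the
      limit.\<close>
    have "(\<lambda>N. (v (- int N))\<^sup>2 + (v (int N))\<^sup>2 + l2norm (D v) * l2norm (P v))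
        \<longlonglongrightarrow> 0 + 0 + l2norm (D v) * l2norm (P v)"
      by (intro tendsto_intros l2_tendsto_zero[OF v]) (auto simp: inj_def)
    then show ?thesis
      using fin by (intro LIMSEQ_le_const) auto
  qed
  have "D (\<lambda>k. u (k + n)) = (\<lambda>k. D u (k + n))" "P (\<lambda>k. u (k + n)) = (\<lambda>k. P u (k + n))"
    by (auto simp: D_def P_def algebra_simps)
  then show ?thesis
    using zero[OF l2_shift[OF assms, of n]] by (simp add: l2norm_shift parallelogram assms)
qed

text \<open>When \<open>D u\<close> has norm 0, the right side of \<open>point_bound\<close> is 0 at
  every index.\<close>

lemma l2norm_D_eq_0_iff:
  assumes "u \<in> l2"
  shows "l2norm (D u) = 0 \<longleftrightarrow> u = (\<lambda>_. 0)"
proof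
  assume "l2norm (D u) = 0"
  then have "(u n)\<^sup>2 \<le> 0" for n
    using point_bound[OF assms, of n] by simp
  then show "u = (\<lambda>_. 0)" by auto
qed (simp add: D_def l2norm_def)

text \<open>The parallelogram identity divided by \<open>(l2norm u)\<^sup>2\<close>. It translates
  the square root of the refined inequality into the norm of \<open>P u\<close>.\<close>

lemma l2norm_P_eq:
  assumes "u \<in> l2" "u \<noteq> (\<lambda>_. 0)"
  shows "sqrt (4 - (l2norm (D u))\<^sup>2 / (l2norm u)\<^sup>2) * l2norm u = l2norm (P u)"
proof -
  have "l2norm u > 0"
    using assms l2norm_eq_0_iff l2norm_nonneg[of u] by fastforce
  then have "4 - (l2norm (D u))\<^sup>2 / (l2norm u)\<^sup>2 = (l2norm (P u) / l2norm u)\<^sup>2"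
    using parallelogram(3)[OF assms(1)] by (simp add: field_simps)
  then have "sqrt (4 - (l2norm (D u))\<^sup>2 / (l2norm u)\<^sup>2) = l2norm (P u) / l2norm u"
    by (simp add: l2norm_nonneg)
  then show ?thesis using \<open>l2norm u > 0\<close> by simp
qed

text \<open>Strictness survives the supremum because the bound in \<open>point_bound\<close> does
  not depend on the index and is itself strictly below the right side.\<close>

lemma sup_less:
  assumes "u \<in> l2" "u \<noteq> (\<lambda>_. 0)"
  shows "(SUP n. (u n)\<^sup>2) < l2norm u * l2norm (D u)"
proof -
  have pos: "l2norm u > 0" "l2norm (D u) > 0"
    using assms l2norm_eq_0_iff l2norm_D_eq_0_iff l2norm_nonneg[of u] l2norm_nonneg[of "D u"]
    by (fastforce simp: less_le)+
  have "(l2norm (P u))\<^sup>2 < (2 * l2norm u)\<^sup>2"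
    using parallelogram(3)[OF assms(1)] zero_less_power[OF pos(2), of 2]
    by (simp only: power_mult_distrib power2_eq_square[of "2::real"])
  then have "l2norm (P u) < 2 * l2norm u"
    by (rule power2_less_imp_less) (simp add: l2norm_nonneg)
  then have "l2norm (D u) * l2norm (P u) < l2norm (D u) * (2 * l2norm u)"
    by (intro mult_strict_left_mono pos)
  moreover have "(SUP n. (u n)\<^sup>2) \<le> 1/2 * (l2norm (D u) * l2norm (P u))"
    by (intro cSUP_least point_bound assms) simp
  ultimately show ?thesis by (simp add: algebra_simps)
qed

section \<open>Two-sided geometric sequences: norms, equality, sharpness\<close>

lemma has_sum_power_square:
  fixes r :: real
  assumes "\<bar>r\<bar> < 1"
  shows "((\<lambda>n. c * (r\<^sup>2) ^ n) has_sum (c / (1 - r\<^sup>2))) UNIV"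
proof -
  have "r\<^sup>2 < 1" using assms by (simp add: abs_square_less_1)
  then have "(\<lambda>n. (r\<^sup>2) ^ n) sums (1 / (1 - r\<^sup>2))"
    by (intro geometric_sums) simp
  then have "((\<lambda>n. (r\<^sup>2) ^ n) has_sum (1 / (1 - r\<^sup>2))) UNIV"
    by (intro sums_nonneg_imp_has_sum) auto
  from has_sum_cmult_right[OF this, of c] show ?thesis by simp
qed

lemma geo_norms:
  fixes r c :: real
  assumes "\<bar>r\<bar> < 1"
  defines "u \<equiv> \<lambda>n. c * geo r n"
  shows "u \<in> l2"
    and "(l2norm u)\<^sup>2 = c\<^sup>2 * (1 + r\<^sup>2) / (1 - r\<^sup>2)"
    and "(l2norm (D u))\<^sup>2 = 2 * c\<^sup>2 * (1 - r) / (1 + r)"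
    and "(l2norm (P u))\<^sup>2 = 2 * c\<^sup>2 * (1 + r) / (1 - r)"
proof -
  have r: "r\<^sup>2 < 1" "1 - r > 0" "1 + r > 0"
    using assms by (auto simp: abs_square_less_1)
  have fac: "1 - r\<^sup>2 = (1 - r) * (1 + r)"
    by (simp add: power2_eq_square algebra_simps)
  have "nat \<bar>int n + 1\<bar> = Suc n" "nat \<bar>- int n - 1\<bar> = Suc n" for n
    by auto
  then have g: "geo r (1 + int n) = r ^ Suc n" "geo r (- int n - 1) = r ^ Suc n" for n
    by (simp_all only: geo_def add.commute[of 1])
  have pw: "(r ^ n)\<^sup>2 = (r\<^sup>2) ^ n" for n
    by (simp flip: power_mult add: mult.commute)
  \<comment> \<open>The negative half starts at index -1, hence the extra factor
    \<open>r\<^sup>2\<close>.\<close>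
  have U: "(u (int n))\<^sup>2 = c\<^sup>2 * (r\<^sup>2) ^ n" "(u (- int n - 1))\<^sup>2 = (c\<^sup>2 * r\<^sup>2) * (r\<^sup>2) ^ n" for n
    by (simp_all add: u_def g geo_def[of r "int n"] power_mult_distrib pw)
  have "((\<lambda>k. (u k)\<^sup>2) has_sum (c\<^sup>2 / (1 - r\<^sup>2) + c\<^sup>2 * r\<^sup>2 / (1 - r\<^sup>2))) UNIV"
    by (intro has_sum_int_halves; simp only: U has_sum_power_square[OF assms(1)])
  then have *: "((\<lambda>k. (u k)\<^sup>2) has_sum (c\<^sup>2 * (1 + r\<^sup>2) / (1 - r\<^sup>2))) UNIV"
    by (simp add: algebra_simps add_divide_distrib)
  show u: "u \<in> l2" using * by (rule l2I)
  show S: "(l2norm u)\<^sup>2 = c\<^sup>2 * (1 + r\<^sup>2) / (1 - r\<^sup>2)" using * by (rule l2norm_sqI)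
  \<comment> \<open>Reflection of the edges changes only the sign, so both halves contribute the
    same series.\<close>
  have "D u (int n) = - (c * (1 - r)) * r ^ n" "D u (- int n - 1) = c * (1 - r) * r ^ n" for n
    by (simp_all add: D_def u_def g add.commute[of _ 1] geo_def[of r "int n"]
        geo_def[of r "- int n"] algebra_simps)
  then have V: "(D u (int n))\<^sup>2 = (c * (1 - r))\<^sup>2 * (r\<^sup>2) ^ n"
    "(D u (- int n - 1))\<^sup>2 = (c * (1 - r))\<^sup>2 * (r\<^sup>2) ^ n" for n
    by (simp_all only: power_mult_distrib power2_minus pw)
  have "((\<lambda>k. (D u k)\<^sup>2) has_sum
      ((c * (1 - r))\<^sup>2 / (1 - r\<^sup>2) + (c * (1 - r))\<^sup>2 / (1 - r\<^sup>2))) UNIV"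
    by (intro has_sum_int_halves; simp only: V has_sum_power_square[OF assms(1)])
  then have "(l2norm (D u))\<^sup>2 = (c * (1 - r))\<^sup>2 / (1 - r\<^sup>2) + (c * (1 - r))\<^sup>2 / (1 - r\<^sup>2)"
    by (rule l2norm_sqI)
  also have "\<dots> = 2 * c\<^sup>2 * (1 - r) / (1 + r)"
    using r(2,3) unfolding fac
    by (simp add: divide_simps) (simp add: algebra_simps power2_eq_square)
  finally show E: "(l2norm (D u))\<^sup>2 = 2 * c\<^sup>2 * (1 - r) / (1 + r)" .
  have "(l2norm (P u))\<^sup>2 = 4 * (c\<^sup>2 * (1 + r\<^sup>2) / (1 - r\<^sup>2)) - 2 * c\<^sup>2 * (1 - r) / (1 + r)"
    using parallelogram(3)[OF u] S E by simp
  also have "\<dots> = 2 * c\<^sup>2 * (1 + r) / (1 - r)"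
    using r(2,3) unfolding fac
    by (simp add: divide_simps) (simp add: algebra_simps power2_eq_square)
  finally show "(l2norm (P u))\<^sup>2 = 2 * c\<^sup>2 * (1 + r) / (1 - r)" .
qed

text \<open>Equality case of Cauchy-Schwarz: \<open>\<bar>D u\<bar>\<close> is the constant multiple
  \<open>(1 - r) / (1 + r)\<close> of \<open>\<bar>P u\<bar>\<close>. In the product of the two
  norms these factors cancel and \<open>2 * c\<^sup>2\<close> remains.\<close>

lemma geo_equality:
  fixes r c :: real
  assumes "\<bar>r\<bar> < 1" "c \<noteq> 0"
  defines "u \<equiv> \<lambda>n. c * geo r n"
  shows "(u 0)\<^sup>2 = 1/2 * sqrt (4 - (l2norm (D u))\<^sup>2 / (l2norm u)\<^sup>2) * l2norm u * l2norm (D u)"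
    and "(l2norm (D u))\<^sup>2 / (l2norm u)\<^sup>2 = 2 - 4 * r / (1 + r\<^sup>2)"
proof -
  have r: "1 - r > 0" "1 + r > 0" "1 + r\<^sup>2 > 0"
    using assms by (auto simp: add_pos_nonneg)
  have fac: "1 - r\<^sup>2 = (1 - r) * (1 + r)"
    by (simp add: power2_eq_square algebra_simps)
  note n = geo_norms[OF assms(1), of c, folded u_def]
  have u0: "u 0 = c" by (simp add: u_def geo_def)
  then have "u \<noteq> (\<lambda>_. 0)" using assms(2) by auto
  have cancel: "2 * c\<^sup>2 * x / y * (2 * c\<^sup>2 * y / x) = (2 * c\<^sup>2)\<^sup>2" if "x \<noteq> 0" "y \<noteq> 0" for x y
    using that by (simp add: power2_eq_square)
  have "(l2norm (P u) * l2norm (D u))\<^sup>2 = (2 * c\<^sup>2)\<^sup>2"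
    using cancel[of "1 + r" "1 - r"] r unfolding power_mult_distrib[of "l2norm (P u)"] n by simp
  then have "l2norm (P u) * l2norm (D u) = 2 * c\<^sup>2"
    using power2_eq_imp_eq l2norm_nonneg by (metis mult_nonneg_nonneg zero_le_numeral zero_le_power2)
  then show "(u 0)\<^sup>2
      = 1/2 * sqrt (4 - (l2norm (D u))\<^sup>2 / (l2norm u)\<^sup>2) * l2norm u * l2norm (D u)"
    using l2norm_P_eq[OF n(1) \<open>u \<noteq> _\<close>] u0 by (simp add: mult.assoc)
  have "(l2norm (D u))\<^sup>2 / (l2norm u)\<^sup>2 = 2 * (1 - r)\<^sup>2 / (1 + r\<^sup>2)"
    using r assms(2) unfolding n fac
    by (simp add: divide_simps) (simp add: algebra_simps power2_eq_square)
  \<comment> \<open>This form isolates \<open>r / (1 + r\<^sup>2)\<close>, the quantity to be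
    matched with a prescribed \<open>d\<close>.\<close>
  also have "\<dots> = 2 - 4 * r / (1 + r\<^sup>2)"
    using r by (simp add: field_simps power2_eq_square)
  finally show "(l2norm (D u))\<^sup>2 / (l2norm u)\<^sup>2 = 2 - 4 * r / (1 + r\<^sup>2)" .
qed

text \<open>Testing on \<open>geo r\<close>, whose value at 0 is 1, bounds 1 by \<open>C\<close>
  times the product of the norms. That product tends to 1 as \<open>r\<close> increases to
  1.\<close>

lemma sharp:
  assumes "\<forall>u\<in>l2. (SUP n. (u n)\<^sup>2) \<le> C * (l2norm u * l2norm (D u))"
  shows "1 \<le> C"
proof -
  have bound: "1 \<le> C * sqrt (2 * (1 + r\<^sup>2) / (1 + r)\<^sup>2)" if "0 < r" "r < 1" for r :: real
  proof -
    have r: "\<bar>r\<bar> < 1" "1 - r > 0" "1 + r > 0" using that by auto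
    have fac: "1 - r\<^sup>2 = (1 - r) * (1 + r)"
      by (simp add: power2_eq_square algebra_simps)
    note n = geo_norms[OF r(1), of 1, simplified]
    have "(l2norm (geo r) * l2norm (D (geo r)))\<^sup>2 = 2 * (1 + r\<^sup>2) / (1 + r)\<^sup>2"
      using r unfolding power_mult_distrib n fac
    by (simp add: divide_simps) (simp add: power2_eq_square algebra_simps)
    then have eq: "l2norm (geo r) * l2norm (D (geo r)) = sqrt (2 * (1 + r\<^sup>2) / (1 + r)\<^sup>2)"
      by (metis real_sqrt_unique l2norm_nonneg mult_nonneg_nonneg)
    \<comment> \<open>A real supremum dominates its members only for a bounded family;
      \<open>point_bound\<close> supplies the bound.\<close>
    have "bdd_above (range (\<lambda>n. (geo r n)\<^sup>2))"
      using point_bound[OF n(1)] by (intro bdd_aboveI2)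
    then have "(geo r 0)\<^sup>2 \<le> (SUP n. (geo r n)\<^sup>2)"
      by (intro cSUP_upper) auto
    also have "\<dots> \<le> C * (l2norm (geo r) * l2norm (D (geo r)))"
      by (rule bspec[OF assms n(1)])
    finally show ?thesis
      unfolding eq by (simp add: geo_def)
  qed
  have "((\<lambda>r. C * sqrt (2 * (1 + r\<^sup>2) / (1 + r)\<^sup>2)) \<longlongrightarrow> C * sqrt (2 * (1 + 1\<^sup>2) / (1 + 1)\<^sup>2))
      (at_left (1::real))"
    by (intro tendsto_intros) auto
  moreover have "\<forall>\<^sub>F r in at_left (1::real). 1 \<le> C * sqrt (2 * (1 + r\<^sup>2) / (1 + r)\<^sup>2)"
    by (rule eventually_mono[OF eventually_at_left_real[OF zero_less_one]]) (rule bound; simp)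
  ultimately have "1 \<le> C * sqrt (2 * (1 + 1\<^sup>2) / (1 + 1)\<^sup>2)"
    by (rule tendsto_lowerbound) simp
  then show ?thesis by simp
qed

section \<open>Green's functions: uniqueness and explicit form\<close>

text \<open>Uniqueness of Green's function: a decaying solution would satisfy \<open>b\<^sup>2 \<parallel>u\<parallel>\<^sup>2 \<le> 4 \<parallel>u\<parallel>\<^sup>2\<close>,
  by \<open>(x + y)\<^sup>2 \<le> 2 x\<^sup>2 + 2 y\<^sup>2\<close>.\<close>

lemma three_term_eq_0:
  fixes b :: real
  assumes "u \<in> l2" "\<bar>b\<bar> > 2" "\<And>n. u (n + 1) + u (n - 1) = b * u n"
  shows "u = (\<lambda>_. 0)"
proof -
  let ?p = "\<lambda>n. u (n + 1)" and ?m = "\<lambda>n. u (n + (-1))"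
  have "((\<lambda>k. b\<^sup>2 * (u k)\<^sup>2) has_sum b\<^sup>2 * (l2norm u)\<^sup>2) UNIV"
    by (intro has_sum_cmult_right has_sum_l2norm_sq assms)
  moreover have "((\<lambda>k. 2 * (?p k)\<^sup>2 + 2 * (?m k)\<^sup>2) has_sum
      (2 * (l2norm ?p)\<^sup>2 + 2 * (l2norm ?m)\<^sup>2)) UNIV"
    by (intro has_sum_add has_sum_cmult_right has_sum_l2norm_sq l2_shift assms)
  moreover have "b\<^sup>2 * (u k)\<^sup>2 \<le> 2 * (?p k)\<^sup>2 + 2 * (?m k)\<^sup>2" for k
  proof -
    have "b\<^sup>2 * (u k)\<^sup>2 = (?p k + ?m k)\<^sup>2"
      using assms(3)[of k] by (simp add: power_mult_distrib)
    also have "\<dots> = 2 * (?p k)\<^sup>2 + 2 * (?m k)\<^sup>2 - (?p k - ?m k)\<^sup>2"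
      by (simp add: power2_eq_square algebra_simps)
    finally show ?thesis by simp
  qed
  ultimately have "b\<^sup>2 * (l2norm u)\<^sup>2 \<le> 2 * (l2norm ?p)\<^sup>2 + 2 * (l2norm ?m)\<^sup>2"
    by (rule has_sum_mono)
  then have "(b\<^sup>2 - 4) * (l2norm u)\<^sup>2 \<le> 0"
    using l2norm_shift[OF assms(1), of 1] l2norm_shift[OF assms(1), of "-1"]
    by (simp add: algebra_simps)
  moreover have "b\<^sup>2 - 4 > 0"
    using assms(2) power_strict_mono[of 2 "\<bar>b\<bar>" 2] by simp
  ultimately have "(l2norm u)\<^sup>2 \<le> 0"
    by (simp add: mult_le_0_iff)
  then show ?thesis
    using l2norm_eq_0_iff[OF assms(1)] by simp
qed

text \<open>Both branches become one recurrence up to sign, with middle coefficient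
  \<open>2 + \<mu>\<close>. Its absolute value exceeds 2 exactly when \<open>-\<mu>\<close> lies
  outside [0,4].\<close>

lemma A_op_eq: "A_op \<mu> u n = (if \<mu> > 0 then -1 else 1) * (u (n + 1) + u (n - 1) - (2 + \<mu>) * u n)"
  by (simp add: A_op_def Dstar_def D_def algebra_simps)

text \<open>The difference of two solutions is in \<open>l2\<close> and solves the homogeneous
  recurrence.\<close>

lemma A_op_inj:
  assumes "u \<in> l2" "v \<in> l2" "\<bar>2 + \<mu>\<bar> > 2" "A_op \<mu> u = A_op \<mu> v"
  shows "u = v"
proof -
  let ?w = "\<lambda>n. u n - v n"
  have "(\<lambda>n. 2 * (u n)\<^sup>2 + 2 * (v n)\<^sup>2) summable_on UNIV"
    using assms(1,2) unfolding l2_def by (auto intro!: summable_on_add summable_on_cmult_right)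
  moreover have "(?w n)\<^sup>2 \<le> 2 * (u n)\<^sup>2 + 2 * (v n)\<^sup>2" for n
    using zero_le_power2[of "u n + v n"] by (simp add: power2_eq_square algebra_simps)
  ultimately have "?w \<in> l2"
    unfolding l2_def by (auto intro: summable_on_comparison_test)
  moreover have "?w (n + 1) + ?w (n - 1) = (2 + \<mu>) * ?w n" for n
    using fun_cong[OF assms(4), of n] by (auto simp: A_op_eq algebra_simps split: if_splits)
  ultimately have "?w = (\<lambda>_. 0)"
    using assms(3) by (intro three_term_eq_0)
  then show ?thesis by (auto simp: fun_eq_iff)
qed

text \<open>Both \<open>r^n\<close> and \<open>r^(-n)\<close> solve the homogeneous recurrence;
  gluing them at 0 leaves the defect \<open>2 * r - (r + 1 / r)\<close> there.\<close>

lemma geo_three_term: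
  fixes r :: real
  assumes "r \<noteq> 0"
  shows "geo r (n + 1) + geo r (n - 1) - (r + 1 / r) * geo r n = (r - 1 / r) * delta n"
proof -
  consider "n = 0" | m where "n = int (Suc m)" | m where "n = - int (Suc m)"
    by (metis int_cases3 gr0_implies_Suc)
  then show ?thesis
  proof cases
    case (2 m)
    then have "nat \<bar>n + 1\<bar> = Suc (Suc m)" "nat \<bar>n - 1\<bar> = m" "nat \<bar>n\<bar> = Suc m" "n \<noteq> 0"
      by auto
    then show ?thesis using assms by (simp add: geo_def delta_def field_simps)
  next
    case (3 m)
    then have "nat \<bar>n + 1\<bar> = m" "nat \<bar>n - 1\<bar> = Suc (Suc m)" "nat \<bar>n\<bar> = Suc m" "n \<noteq> 0"
      by auto
    then show ?thesis using assms by (simp add: geo_def delta_def field_simps)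
  qed (simp add: geo_def delta_def algebra_simps)
qed

text \<open>A single \<open>r\<close> serves both purposes:
  \<open>r / (1 + r\<^sup>2) = (2 - d) / 4\<close> encodes the norm ratio \<open>d\<close> as well
  as \<open>r + 1 / r = 2 + lambda_of d\<close>.\<close>

lemma green_geo:
  assumes "0 < d" "d < 4" "d \<noteq> 2"
  obtains r c where "\<bar>r\<bar> < 1" "c \<noteq> 0" "2 - 4 * r / (1 + r\<^sup>2) = d"
    "A_op (lambda_of d) (\<lambda>n. c * geo r n) = delta" "\<bar>2 + lambda_of d\<bar> > 2"
proof -
  \<comment> \<open>Here \<open>2 + lambda_of d = 2 / t\<close> and
    \<open>0 < \<bar>t\<bar> < 1\<close>. The choice of \<open>r\<close> is the root of
    \<open>t r^2 - 2 r + t = 0\<close> inside the unit disc, in rationalised form.\<close>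
  define t where "t = (2 - d) / 2"
  define s where "s = sqrt (1 - t\<^sup>2)"
  define r where "r = t / (1 + s)"
  define \<sigma> where "\<sigma> = (if lambda_of d > 0 then -1 else 1 :: real)"
  have t: "t \<noteq> 0" "\<bar>t\<bar> < 1" using assms by (auto simp: t_def field_simps abs_if)
  then have t2: "t\<^sup>2 < 1" by (simp add: abs_square_less_1)
  then have s: "s > 0" "s\<^sup>2 = 1 - t\<^sup>2" by (auto simp: s_def)
  have r: "r \<noteq> 0" "\<bar>r\<bar> < 1" using t s(1) by (auto simp: r_def abs_div field_simps)
  have "1 + r\<^sup>2 = ((1 + s)\<^sup>2 + t\<^sup>2) / (1 + s)\<^sup>2"
    using s(1) by (simp add: r_def power_divide field_simps)
  also have "(1 + s)\<^sup>2 + t\<^sup>2 = 2 * (1 + s)"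
    using s(2) by (simp add: power2_sum)
  also have "\<dots> / (1 + s)\<^sup>2 = 2 / (1 + s)"
    using s(1) by (simp add: divide_simps) (simp add: algebra_simps power2_eq_square)
  finally have r1: "1 + r\<^sup>2 = 2 / (1 + s)" .
  have rt: "r / (1 + r\<^sup>2) = t / 2"
    using s(1) unfolding r1 by (simp add: r_def)
  have lam: "2 + lambda_of d = 2 / t"
    using assms by (simp add: lambda_of_def t_def field_simps)
  have rr: "r + 1 / r = 2 / t"
  proof -
    have "r + 1 / r = (1 + r\<^sup>2) / r" using r(1) by (simp add: field_simps power2_eq_square)
    also have "\<dots> = 1 / (r / (1 + r\<^sup>2))" by simp
    finally show ?thesis unfolding rt by simp
  qed
  have nz: "r - 1 / r \<noteq> 0"
    using r abs_square_less_1[of r] by (auto simp: field_simps power2_eq_square)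
  \<comment> \<open>Cancels the defect at 0 and the sign \<open>\<sigma>\<close> from
    \<open>A_op_eq\<close>, as \<open>\<sigma> * \<sigma> = 1\<close>.\<close>
  define c where "c = \<sigma> / (r - 1 / r)"
  have sg: "\<sigma> * \<sigma> = 1" "\<sigma> \<noteq> 0" by (auto simp: \<sigma>_def)
  have "A_op (lambda_of d) (\<lambda>n. c * geo r n) n = delta n" for n
  proof -
    have "A_op (lambda_of d) (\<lambda>n. c * geo r n) n
        = \<sigma> * c * (geo r (n + 1) + geo r (n - 1) - (r + 1 / r) * geo r n)"
      unfolding A_op_eq lam rr \<sigma>_def[symmetric] by (simp add: algebra_simps)
    also have "\<dots> = \<sigma> * \<sigma> * delta n"
      unfolding geo_three_term[OF r(1)] c_def using nz by simp
    finally show ?thesis by (simp add: sg)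
  qed
  moreover have "2 - 4 * r / (1 + r\<^sup>2) = d"
    using rt by (simp add: t_def field_simps)
  moreover have "\<bar>2 + lambda_of d\<bar> > 2"
    using t unfolding lam by (simp add: abs_div field_simps)
  ultimately show ?thesis
    using that[of r c] r(2) nz sg(2) by (auto simp: c_def)
qed

section \<open>The two inequalities, sharpness and the extremals\<close>

theorem corollary2p2:
  "(\<forall>u\<in>l2. (SUP n. (u n)\<^sup>2) \<le> l2norm u * l2norm (D u))
   \<and> (\<forall>C::real. (\<forall>u\<in>l2. (SUP n. (u n)\<^sup>2) \<le> C * (l2norm u * l2norm (D u))) \<longrightarrow> 1 \<le> C)
   \<and> \<not> (\<exists>u\<in>l2. u \<noteq> (\<lambda>_. 0) \<and> (SUP n. (u n)\<^sup>2) = l2norm u * l2norm (D u))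
   \<and> (\<forall>u\<in>l2. u \<noteq> (\<lambda>_. 0) \<longrightarrow>
        (u 0)\<^sup>2 \<le> 1/2 * sqrt (4 - (l2norm (D u))\<^sup>2 / (l2norm u)\<^sup>2) * l2norm u * l2norm (D u))
   \<and> (\<forall>d::real. 0 < d \<and> d < 4 \<and> d \<noteq> 2 \<longrightarrow>
        (\<exists>!G. G \<in> l2 \<and> A_op (lambda_of d) G = delta)
        \<and> (let u = green (lambda_of d) in
             (u 0)\<^sup>2 = 1/2 * sqrt (4 - (l2norm (D u))\<^sup>2 / (l2norm u)\<^sup>2) * l2norm u * l2norm (D u)
             \<and> (l2norm (D u))\<^sup>2 / (l2norm u)\<^sup>2 = d))
   \<and> (delta \<in> l2
        \<and> (delta 0)\<^sup>2 = 1/2 * sqrt (4 - (l2norm (D delta))\<^sup>2 / (l2norm delta)\<^sup>2)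
                            * l2norm delta * l2norm (D delta)
        \<and> (l2norm (D delta))\<^sup>2 / (l2norm delta)\<^sup>2 = 2)"
proof (intro conjI)
  show "\<forall>u\<in>l2. (SUP n. (u n)\<^sup>2) \<le> l2norm u * l2norm (D u)"
  proof
    fix u assume "u \<in> l2"
    \<comment> \<open>The strict bound covers nonzero \<open>u\<close>; for the zero sequence both
      sides are 0.\<close>
    then show "(SUP n. (u n)\<^sup>2) \<le> l2norm u * l2norm (D u)"
      using sup_less[of u] by (cases "u = (\<lambda>_. 0)") (auto simp: l2norm_def)
  qed
  show "\<forall>C::real. (\<forall>u\<in>l2. (SUP n. (u n)\<^sup>2) \<le> C * (l2norm u * l2norm (D u))) \<longrightarrow> 1 \<le> C"
    using sharp by blast
  show "\<not> (\<exists>u\<in>l2. u \<noteq> (\<lambda>_. 0) \<and> (SUP n. (u n)\<^sup>2) = l2norm u * l2norm (D u))"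
    using sup_less by fastforce
  show "\<forall>u\<in>l2. u \<noteq> (\<lambda>_. 0) \<longrightarrow>
      (u 0)\<^sup>2 \<le> 1/2 * sqrt (4 - (l2norm (D u))\<^sup>2 / (l2norm u)\<^sup>2) * l2norm u * l2norm (D u)"
    using point_bound[of _ 0] by (simp add: mult.assoc l2norm_P_eq mult.commute[of "l2norm (D _)"]
      flip: mult.assoc[of "sqrt _"])
  show "\<forall>d::real. 0 < d \<and> d < 4 \<and> d \<noteq> 2 \<longrightarrow>
        (\<exists>!G. G \<in> l2 \<and> A_op (lambda_of d) G = delta)
        \<and> (let u = green (lambda_of d) in
             (u 0)\<^sup>2 = 1/2 * sqrt (4 - (l2norm (D u))\<^sup>2 / (l2norm u)\<^sup>2) * l2norm u * l2norm (D u)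
             \<and> (l2norm (D u))\<^sup>2 / (l2norm u)\<^sup>2 = d)"
  proof (intro allI impI)
    fix d :: real
    assume "0 < d \<and> d < 4 \<and> d \<noteq> 2"
    then obtain r c where rc: "\<bar>r\<bar> < 1" "c \<noteq> 0" "2 - 4 * r / (1 + r\<^sup>2) = d"
      "A_op (lambda_of d) (\<lambda>n. c * geo r n) = delta" "\<bar>2 + lambda_of d\<bar> > 2"
      using green_geo by metis
    \<comment> \<open>\<open>green\<close> is a definite description, so unique existence must be
      known before it can be identified with the geometric solution.\<close>
    have ex: "\<exists>!G. G \<in> l2 \<and> A_op (lambda_of d) G = delta"
      using geo_norms(1)[OF rc(1), of c] rc(4) A_op_inj[OF _ _ rc(5)] by metis
    then have "green (lambda_of d) = (\<lambda>n. c * geo r n)"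
      unfolding green_def using geo_norms(1)[OF rc(1), of c] rc(4) by (intro the1_equality) auto
    then show "(\<exists>!G. G \<in> l2 \<and> A_op (lambda_of d) G = delta)
        \<and> (let u = green (lambda_of d) in
             (u 0)\<^sup>2 = 1/2 * sqrt (4 - (l2norm (D u))\<^sup>2 / (l2norm u)\<^sup>2) * l2norm u * l2norm (D u)
             \<and> (l2norm (D u))\<^sup>2 / (l2norm u)\<^sup>2 = d)"
      using ex geo_equality[OF rc(1,2)] rc(3) by (simp only: Let_def)
  qed
  \<comment> \<open>With \<open>r = 0\<close> the ratio \<open>2 - 4 * r / (1 + r\<^sup>2)\<close>
    is 2.\<close>
  have delta: "delta = (\<lambda>n. 1 * geo 0 n)"
    by (auto simp: delta_def geo_def)
  show "delta \<in> l2"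
    unfolding delta by (rule geo_norms) simp
  show "(delta 0)\<^sup>2 = 1/2 * sqrt (4 - (l2norm (D delta))\<^sup>2 / (l2norm delta)\<^sup>2)
      * l2norm delta * l2norm (D delta)"
    unfolding delta by (rule geo_equality) auto
  show "(l2norm (D delta))\<^sup>2 / (l2norm delta)\<^sup>2 = 2"
    unfolding delta using geo_equality(2)[of 0 1] by simp
qed

end
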